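(* Let $\mathbb{D} = \{z \in \mathbb{C} : |z| < 1\}$ and let $f : \mathbb{D} \to \mathbb{D}$ be a holomorphic function. For an arbitrary holomorphic function $p : \mathbb{D} \to \mathbb{D}$ with $p(0) = 0$ there exists a function $P_\lambda(w)$, holomorphic for $\lambda, w \in \mathbb{D}$ and with values in $\mathbb{D}$, such that $$P_\lambda\left(\frac{w}{\lambda}\right) = p(w)\, f(P_\lambda(w))$$ for $\lambda, w \in \mathbb{D}$, $\lambda \neq 0$, where $$P_\lambda(w) = \lim_{n\to\infty} p(\lambda w) f\Big(p(\lambda^2 w) f\big(\cdots p(\lambda^n w) f(z)\cdots\big)\Big),$$ the limit being independent of $z \in \mathbb{D}$.
   Context: The infinite composition is the limit of finite compositions: put $h_j(z) = p(\lambda^j w) f(z)$ for $z \in \mathbb{D}$ and $j \ge 1$; then $P_\lambda(w) = \lim_{n\to\infty} h_1(h_2(\cdots h_n(z)\cdots))$, the limit being constant in $z$. In the functional equation, $P_\lambda(w/\lambda)$ is given by the same formula with $w$ replaced by $w/\lambda$; it involves only the values $p(\lambda^{j-1} w)$, $j \ge 1$, so it makes sense for every $w \in \mathbb{D}$ even when $w/\lambda \notin \mathbb{D}$. *)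

theory Defs
  imports "HOL-Complex_Analysis.Complex_Analysis"
begin

abbreviation unit_disc :: "complex set" where
  "unit_disc \<equiv> ball 0 1"

text \<open>
  Joint holomorphy in two complex variables, intended for open \<open>S\<close>: the total derivative exists
  and is complex linear.  (The library notion \<open>has_derivative\<close> by itself is only real linear.)
\<close>
definition holomorphic2_on ::
    "(complex \<Rightarrow> complex \<Rightarrow> complex) \<Rightarrow> (complex \<times> complex) set \<Rightarrow> bool" where
  "holomorphic2_on F S \<longleftrightarrow>
     (\<forall>x\<in>S. \<exists>a b. ((\<lambda>(u, v). F u v) has_derivative (\<lambda>(h, k). a * h + b * k)) (at x within S))"

text \<open>
  \<open>inner_comp h n = h 1 \<circ> h 2 \<circ> \<dots> \<circ> h n\<close>; the new factor is added on the inside.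
\<close>
primrec inner_comp :: "(nat \<Rightarrow> 'a \<Rightarrow> 'a) \<Rightarrow> nat \<Rightarrow> 'a \<Rightarrow> 'a" where
  "inner_comp h 0 = id"
| "inner_comp h (Suc n) = inner_comp h n \<circ> h (Suc n)"

text \<open>
  This only uses values of \<open>p\<close> at \<open>l\<^sup>j w\<close> with \<open>j \<ge> 1\<close>, so it is meaningful whenever \<open>l\<close> and
  \<open>l w\<close> lie in the unit disc, in particular at \<open>w / l\<close> for \<open>l, w\<close> in the disc and \<open>l \<noteq> 0\<close>.
\<close>
definition finite_comp ::
    "(complex \<Rightarrow> complex) \<Rightarrow> (complex \<Rightarrow> complex) \<Rightarrow> complex \<Rightarrow> complex \<Rightarrow> nat \<Rightarrow> complex \<Rightarrow> complex" where
  "finite_comp f p l w = inner_comp (\<lambda>j z. p (l ^ j * w) * f z)"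

end

theory Submission
  imports Defs
begin

text \<open>
  By the Schwarz lemma the factor \<open>p (\<lambda>\<^sup>j w)\<close> is at most \<open>a\<^sup>j\<close> in modulus when \<open>\<bar>\<lambda>\<bar> \<le> a\<close> and
  \<open>\<bar>\<lambda> w\<bar> \<le> a\<close> with \<open>a < 1\<close>.  Hence every map \<open>z \<mapsto> p (\<lambda>\<^sup>j w) f z\<close> sends the unit disc into the
  closed disc of radius \<open>a\<close>, where \<open>f\<close> has some Lipschitz constant \<open>L\<close>.  On that disc the
  composition of the first \<open>n\<close> maps has a Lipschitz constant of at most \<open>\<Prod>j<n. L a\<^sup>j\<close>, which
  tends to 0 no matter how large \<open>L\<close> is.  So the finite compositions converge, uniformly in the
  parameters and independently of the starting point; the limit is jointly continuous and
  holomorphic in each variable, hence jointly holomorphic by Cauchy's estimate (Osgood's lemma).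
\<close>

section \<open>Joint holomorphy from separate holomorphy and joint continuity\<close>

text \<open>For x near u the functions \<open>F x\<close> and \<open>F u\<close> are uniformly close
  on a disc around v, so Cauchy's estimate makes their derivatives close there; continuity of
  \<open>deriv (F u)\<close> at v does the rest.\<close>

lemma continuous_at_deriv_snd:
  fixes F :: "complex \<Rightarrow> complex \<Rightarrow> complex"
  assumes V: "open V"
    and cont: "continuous_on (U \<times> V) (\<lambda>(u, v). F u v)"
    and hol: "\<And>u. u \<in> U \<Longrightarrow> F u holomorphic_on V"
    and u: "u \<in> U" and v: "v \<in> V"
  shows "continuous (at (u, v) within U \<times> V) (\<lambda>(x, y). deriv (F x) y)"
proof -
  \<comment> \<open>With radius 2r, every disc of radius r about a point of \<open>ball v r\<close>
    still lies in V, so Cauchy's estimate uses the same r at all these points.\<close>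
  obtain r where r: "r > 0" "cball v (2 * r) \<subseteq> V"
  proof -
    obtain s where "s > 0" "cball v s \<subseteq> V"
      using V v open_contains_cball by blast
    then show thesis by (intro that[of "s / 2"]) auto
  qed
  have "((\<lambda>(x, y). deriv (F x) y) \<longlongrightarrow> deriv (F u) v) (at (u, v) within U \<times> V)"
  proof (rule tendstoI)
    fix e :: real assume e: "e > 0"
    have "continuous_on (U \<times> cball v (2 * r)) (\<lambda>(u, v). F u v)"
      using cont r by (elim continuous_on_subset) auto
    \<comment> \<open>Compactness of the closed disc yields one neighbourhood \<open>X\<close> of u
      that serves all t at once. Dividing the bound e * r / 2 by the radius r leaves e / 2 for the
      derivatives.\<close>
    moreover have "e * r / 2 > 0" using e r by simp
    ultimately obtain X where X: "u \<in> X" "open X"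
      and "\<forall>x\<in>X \<inter> U. \<forall>t\<in>cball v (2 * r). dist (case (x, t) of (u, v) \<Rightarrow> F u v)
          (case (u, t) of (u, v) \<Rightarrow> F u v) \<le> e * r / 2"
      using u by (elim continuous_on_prod_compactE[OF _ compact_cball])
    then have FX: "norm (F x t - F u t) \<le> e * r / 2" if "x \<in> X \<inter> U" "t \<in> cball v (2 * r)" for x t
      using that by (simp add: dist_norm)
    have near: "norm (deriv (F x) y - deriv (F u) y) \<le> e / 2"
      if x: "x \<in> X \<inter> U" and y: "y \<in> ball v r" for x y
    proof -
      have sub: "cball y r \<subseteq> cball v (2 * r)"
        using y cball_subset_cball_iff[of y r v "2 * r"] by (auto simp: dist_commute)
      then have subV: "cball y r \<subseteq> V" using r by blast
      have hol': "F z holomorphic_on cball y r" if "z \<in> U" for z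
        using hol[OF that] subV by (rule holomorphic_on_subset)
      have diff: "F z field_differentiable at y" if "z \<in> U" for z
        using hol[OF that] subV V r
        by (intro holomorphic_on_imp_differentiable_at[of _ V]) auto
      have "norm ((deriv ^^ 1) (\<lambda>t. F x t - F u t) y) \<le> fact 1 * (e * r / 2) / r ^ 1"
      proof (rule Cauchy_inequality)
        show "(\<lambda>t. F x t - F u t) holomorphic_on ball y r"
          using x u by (intro holomorphic_intros holomorphic_on_subset[OF hol' ball_subset_cball]) auto
        show "continuous_on (cball y r) (\<lambda>t. F x t - F u t)"
          using x u by (intro continuous_intros holomorphic_on_imp_continuous_on hol') auto
        show "norm (F x t - F u t) \<le> e * r / 2" if "norm (y - t) = r" for t
          using FX[OF x, of t] sub that by (auto simp: dist_norm)
      qed (use r in auto)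
      then show ?thesis
        using r x u diff by simp
    qed
    have "continuous_on V (deriv (F u))"
      using hol[OF u] V by (intro holomorphic_on_imp_continuous_on holomorphic_deriv)
    then have "isCont (deriv (F u)) v"
      using V v by (simp add: continuous_on_eq_continuous_at)
    then have "\<forall>\<^sub>F y in nhds v. dist (deriv (F u) y) (deriv (F u) v) < e / 2"
      using e by (intro tendstoD) (auto simp: isCont_def tendsto_nhds_iff)
    moreover have "\<forall>\<^sub>F y in nhds v. y \<in> ball v r"
      using r by (intro eventually_nhds_in_open) auto
    ultimately have 1: "\<forall>\<^sub>F y in nhds v. y \<in> ball v r \<and> dist (deriv (F u) y) (deriv (F u) v) < e / 2"
      by eventually_elim auto
    have 2: "\<forall>\<^sub>F x in nhds u. x \<in> X"
      using X by (intro eventually_nhds_in_open)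
    have "\<forall>\<^sub>F z in nhds (u, v). fst z \<in> X \<and> snd z \<in> ball v r \<and>
        dist (deriv (F u) (snd z)) (deriv (F u) v) < e / 2"
      unfolding nhds_prod eventually_prod_filter using 2 1 by auto
    then show "\<forall>\<^sub>F z in at (u, v) within U \<times> V.
        dist (case z of (x, y) \<Rightarrow> deriv (F x) y) (deriv (F u) v) < e"
      unfolding eventually_at_filter
    proof eventually_elim
      case (elim z)
      show ?case
      proof
        assume "z \<noteq> (u, v)"
        show "z \<in> U \<times> V \<longrightarrow> dist (case z of (x, y) \<Rightarrow> deriv (F x) y) (deriv (F u) v) < e"
        proof
          assume "z \<in> U \<times> V"
          with elim near[of "fst z" "snd z"]
          have "dist (deriv (F (fst z)) (snd z)) (deriv (F u) (snd z)) \<le> e / 2"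
            by (auto simp: dist_norm)
          with elim dist_triangle[of "deriv (F (fst z)) (snd z)" "deriv (F u) v" "deriv (F u) (snd z)"]
          show "dist (case z of (x, y) \<Rightarrow> deriv (F x) y) (deriv (F u) v) < e"
            by (auto simp: case_prod_unfold)
        qed
      qed
    qed
  qed
  then show ?thesis by (simp add: continuous_within)
qed

text \<open>A total derivative exists once both partial derivatives exist and the second one is
  jointly continuous at the point. It is complex linear because both partials are multiplications by
  complex numbers.\<close>

lemma holomorphic2_on_if_separately_holomorphic:
  fixes F :: "complex \<Rightarrow> complex \<Rightarrow> complex"
  assumes U: "open U" and V: "open V"
    and cont: "continuous_on (U \<times> V) (\<lambda>(u, v). F u v)"
    and hol1: "\<And>v. v \<in> V \<Longrightarrow> (\<lambda>u. F u v) holomorphic_on U"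
    and hol2: "\<And>u. u \<in> U \<Longrightarrow> F u holomorphic_on V"
  shows "holomorphic2_on F (U \<times> V)"
  unfolding holomorphic2_on_def
proof safe
  fix u v assume u: "u \<in> U" and v: "v \<in> V"
  \<comment> \<open>The criterion for partial derivatives needs a convex set in the second variable,
    so V is shrunk to a ball. Since all sets are open, this does not change the derivative at the
    point.\<close>
  obtain r where r: "r > 0" "ball v r \<subseteq> V"
    using V v open_contains_ball by blast
  let ?Y = "ball v r"
  have "((\<lambda>(x, y). F x y) has_derivative
      (\<lambda>(h, k). deriv (\<lambda>x. F x v) u * h + blinfun_mult_right (deriv (F u) v) k)) (at (u, v) within U \<times> ?Y)"
  proof (rule has_derivative_partialsI[where fy = "\<lambda>x y. blinfun_mult_right (deriv (F x) y)"])
    show "((\<lambda>x. F x v) has_derivative (*) (deriv (\<lambda>x. F x v) u)) (at u within U)"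
      using hol1[OF v] U u has_field_derivative_def holomorphic_derivI by blast
    show "((\<lambda>y. F x y) has_derivative blinfun_mult_right (deriv (F x) y)) (at y within ?Y)"
      if "x \<in> U" "y \<in> ?Y" for x y
    proof -
      have "(F x has_field_derivative deriv (F x) y) (at y within ?Y)"
        using hol2[OF that(1)] V that(2) r by (intro holomorphic_derivI) auto
      then show ?thesis
        by (simp add: has_field_derivative_def)
    qed
    have "continuous (at (u, v) within U \<times> ?Y) (\<lambda>(x, y). deriv (F x) y)"
      using continuous_at_deriv_snd[OF V cont hol2 u v]
      by (rule continuous_within_subset) (use r in auto)
    from bounded_linear.continuous[OF bounded_linear_blinfun_mult_right this]
    show "continuous (at (u, v) within U \<times> ?Y) (\<lambda>(x, y). blinfun_mult_right (deriv (F x) y))"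
      by (simp add: case_prod_unfold)
  qed (use r in auto)
  moreover have "at (u, v) within U \<times> ?Y = at (u, v)" "at (u, v) within U \<times> V = at (u, v)"
    using U V u v r by (auto intro!: at_within_open open_Times)
  ultimately show "\<exists>a b. ((\<lambda>(u, v). F u v) has_derivative (\<lambda>(h, k). a * h + b * k)) (at (u, v) within U \<times> V)"
    by auto
qed

section \<open>Lipschitz constants, compositions and products\<close>

lemma holomorphic_lipschitz_on_cball:
  fixes f :: "complex \<Rightarrow> complex"
  assumes "f holomorphic_on S" "open S" "cball z r \<subseteq> S"
  obtains L where "L \<ge> 0"
    "\<And>x y. x \<in> cball z r \<Longrightarrow> y \<in> cball z r \<Longrightarrow> norm (f x - f y) \<le> L * norm (x - y)"
proof -
  have "continuous_on (cball z r) (deriv f)"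
    using assms holomorphic_deriv holomorphic_on_imp_continuous_on continuous_on_subset by metis
  then have "bounded (deriv f ` cball z r)"
    by (intro compact_imp_bounded compact_continuous_image compact_cball)
  then obtain L where L: "L > 0" "\<And>x. x \<in> cball z r \<Longrightarrow> norm (deriv f x) \<le> L"
    by (auto simp: bounded_pos)
  show thesis
  proof
    show "norm (f x - f y) \<le> L * norm (x - y)" if "x \<in> cball z r" "y \<in> cball z r" for x y
      using that assms L(2)
      by (intro field_differentiable_bound[of "cball z r" f "deriv f"] holomorphic_derivI) auto
  qed (use L in auto)
qed

text \<open>The recursion splits off the innermost map, whereas the functional equation needs the
  outermost one.\<close>

lemma inner_comp_Suc_outer:
  "inner_comp h (Suc n) z = h 1 (inner_comp (\<lambda>j. h (Suc j)) n z)"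
  by (induction n arbitrary: z) auto

lemma finite_comp_0 [simp]: "finite_comp f p l w 0 z = z"
  by (simp add: finite_comp_def)

lemma finite_comp_Suc:
  "finite_comp f p l w (Suc n) z = finite_comp f p l w n (p (l ^ Suc n * w) * f z)"
  by (simp add: finite_comp_def)

text \<open>This is the functional equation at finite level: replacing w by w / l lowers every
  exponent by one, so the outermost factor becomes \<open>p w\<close>.\<close>

lemma finite_comp_Suc_divide:
  assumes "l \<noteq> 0"
  shows "finite_comp f p l (w / l) (Suc n) z = p w * f (finite_comp f p l w n z)"
  using assms by (simp add: finite_comp_def inner_comp_Suc_outer del: inner_comp.simps)

text \<open>The ratio of consecutive products is L * a ^ n, which is eventually below 1/2 in
  modulus. So the products are even summable by the ratio test.\<close>

lemma prod_power_tendsto_0: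
  fixes a L :: real
  assumes "\<bar>a\<bar> < 1"
  shows "(\<lambda>n. \<Prod>j<n. L * a ^ j) \<longlonglongrightarrow> 0"
proof -
  have "(\<lambda>n. \<bar>L * a ^ n\<bar>) \<longlonglongrightarrow> 0"
    using tendsto_mult_right_zero[OF LIMSEQ_power_zero[of a], of L] assms
    by (intro tendsto_rabs_zero) auto
  then have "\<forall>\<^sub>F n in sequentially. \<bar>L * a ^ n\<bar> < 1 / 2"
    by (rule order_tendstoD) auto
  then obtain N where N: "\<And>n. n \<ge> N \<Longrightarrow> \<bar>L * a ^ n\<bar> < 1 / 2"
    by (auto simp: eventually_sequentially)
  have "summable (\<lambda>n. \<Prod>j<n. L * a ^ j)"
  proof (rule summable_ratio_test[of "1 / 2" N])
    fix n assume "n \<ge> N"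
    from mult_right_mono[OF less_imp_le[OF N[OF this]], of "norm (\<Prod>j<n. L * a ^ j)"]
    show "norm (\<Prod>j<Suc n. L * a ^ j) \<le> 1 / 2 * norm (\<Prod>j<n. L * a ^ j)"
      by (simp add: abs_mult mult_ac)
  qed auto
  then show ?thesis by (rule summable_LIMSEQ_zero)
qed

lemma norm_mult_less_1:
  fixes l w :: complex
  assumes "norm l < 1" "norm w < 1" shows "norm (l * w) < 1"
  using mult_strict_mono[of "norm l" 1 "norm w" 1] assms by (simp add: norm_mult)

section \<open>Bounds for the finite compositions\<close>

locale disc_self_maps =
  fixes f p :: "complex \<Rightarrow> complex"
  assumes f_hol: "f holomorphic_on unit_disc"
    and f_disc: "f ` unit_disc \<subseteq> unit_disc"
    and p_hol: "p holomorphic_on unit_disc"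
    and p_disc: "p ` unit_disc \<subseteq> unit_disc"
    and p_0: "p 0 = 0"
begin

text \<open>
  The second condition bounds \<open>l * w\<close> rather than \<open>w\<close>, so that the points \<open>(l, w / l)\<close> of the
  functional equation, which may lie outside the bidisc, are covered as well.
\<close>
definition region :: "real \<Rightarrow> (complex \<times> complex) set" where
  "region a = {(l, w). norm l \<le> a \<and> norm (l * w) \<le> a}"

abbreviation FC :: "complex \<Rightarrow> complex \<Rightarrow> nat \<Rightarrow> complex \<Rightarrow> complex" where
  "FC \<equiv> finite_comp f p"

text \<open>The starting point 0 is an arbitrary choice; \<open>finite_comp_tendsto_P\<close>
  removes it.\<close>

definition P :: "complex \<Rightarrow> complex \<Rightarrow> complex" where
  "P l w = lim (\<lambda>n. FC l w n 0)"

lemma norm_f: "norm z < 1 \<Longrightarrow> norm (f z) < 1"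
  using f_disc by (auto simp: image_subset_iff)

lemma norm_p: "norm z < 1 \<Longrightarrow> norm (p z) \<le> norm z"
  using Schwarz_Lemma(1)[OF p_hol p_0] p_disc by (auto simp: image_subset_iff)

lemma region_nonneg: "(l, w) \<in> region a \<Longrightarrow> 0 \<le> a"
  using order_trans[OF norm_ge_zero] by (auto simp: region_def)

text \<open>Writing the argument as l ^ n * (l * w) shows why bounds on l and l * w suffice,
  whatever the size of w.\<close>

lemma norm_power_mult:
  assumes "(l, w) \<in> region a" shows "norm (l ^ Suc n * w) \<le> a ^ n * a"
proof -
  have "norm (l ^ n) * norm (l * w) \<le> a ^ n * a"
    using assms region_nonneg[OF assms]
    by (intro mult_mono) (auto simp: region_def norm_power intro!: power_mono)
  then show ?thesis by (simp add: norm_mult mult_ac)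
qed

lemma norm_power_mult_less_1:
  assumes "(l, w) \<in> region a" "a < 1" shows "norm (l ^ Suc n * w) < 1"
proof -
  have "0 \<le> a" using assms(1) by (rule region_nonneg)
  then have "a ^ n * a \<le> a"
    using assms(2) by (intro mult_left_le_one_le power_le_one) auto
  then show ?thesis using norm_power_mult[OF assms(1), of n] assms(2) by linarith
qed

lemma factor_norm_le:
  assumes "(l, w) \<in> region a" "a < 1" "norm z < 1"
  shows "norm (p (l ^ Suc n * w) * f z) \<le> a"
proof -
  have a: "0 \<le> a" using assms(1) by (rule region_nonneg)
  have "norm (p (l ^ Suc n * w)) \<le> a ^ n * a"
    using norm_p[OF norm_power_mult_less_1] norm_power_mult assms order_trans by blast
  also have "\<dots> \<le> a"
    using assms(2) a by (intro mult_left_le_one_le power_le_one) auto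
  finally have "norm (p (l ^ Suc n * w)) * norm (f z) \<le> a * 1"
    using norm_f[OF assms(3)] a by (intro mult_mono) auto
  then show ?thesis by (simp add: norm_mult)
qed

lemma norm_finite_comp_le:
  assumes "(l, w) \<in> region a" "a < 1" "norm z < 1"
  shows "norm (FC l w (Suc n) z) \<le> a"
  using assms(3)
proof (induction n arbitrary: z)
  case 0
  then show ?case
    using factor_norm_le[OF assms(1,2), of z 0] by (simp add: finite_comp_Suc)
next
  case (Suc n)
  have "norm (p (l ^ Suc (Suc n) * w) * f z) < 1"
    using factor_norm_le[OF assms(1,2) Suc.prems] assms(2) by (rule le_less_trans)
  from Suc.IH[OF this] show ?case
    by (subst finite_comp_Suc)
qed

section \<open>Contraction and uniform convergence\<close>

lemma finite_comp_lipschitz: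
  assumes a: "a < 1" and K: "(l, w) \<in> region a" and L: "L \<ge> 0"
    and f_lip: "\<And>x y. x \<in> cball 0 a \<Longrightarrow> y \<in> cball 0 a \<Longrightarrow> norm (f x - f y) \<le> L * norm (x - y)"
    and xy: "x \<in> cball 0 a" "y \<in> cball 0 a"
  shows "norm (FC l w n x - FC l w n y) \<le> (\<Prod>j<n. L * a ^ j) * norm (x - y)"
  using xy
proof (induction n arbitrary: x y)
  case (Suc n)
  have a0: "0 \<le> a" using K by (rule region_nonneg)
  let ?c = "p (l ^ Suc n * w)"
  have step: "norm (FC l w (Suc n) x - FC l w (Suc n) y) \<le> (\<Prod>j<n. L * a ^ j) * norm (?c * f x - ?c * f y)"
    unfolding finite_comp_Suc
    using Suc.prems a by (intro Suc.IH) (auto intro!: factor_norm_le[OF K a] simp del: power_Suc)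
  have "norm (?c * f x - ?c * f y) = norm ?c * norm (f x - f y)"
    by (simp add: norm_mult flip: right_diff_distrib)
  also have "\<dots> \<le> a ^ n * (L * norm (x - y))"
  proof (intro mult_mono)
    have "norm ?c \<le> a ^ n * a"
      using norm_p[OF norm_power_mult_less_1] norm_power_mult K a order_trans by blast
    \<comment> \<open>One factor a of the Schwarz bound is given away to match the product indexed
      from 0.\<close>
    also have "\<dots> \<le> a ^ n"
      using a a0 by (intro mult_right_le_one_le) auto
    finally show "norm ?c \<le> a ^ n" .
  qed (use Suc.prems f_lip a0 in auto)
  finally have "(\<Prod>j<n. L * a ^ j) * norm (?c * f x - ?c * f y)
      \<le> (\<Prod>j<n. L * a ^ j) * (a ^ n * (L * norm (x - y)))"
    using L a0 by (intro mult_left_mono prod_nonneg) auto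
  with step show ?case
    by (simp add: mult_ac)
qed simp

text \<open>The point \<open>y\<close> is the value at z of the inner maps with indices n + 1 to m.
  At least one such map is needed to land in the smaller disc, hence the strict inequality.\<close>

lemma finite_comp_prefix:
  assumes "(l, w) \<in> region a" "a < 1" "norm z < 1" "m > n"
  obtains y where "y \<in> cball 0 a" "FC l w m z = FC l w n y"
proof -
  have "\<exists>y\<in>cball 0 a. FC l w (Suc n + k) z = FC l w n y" for k
    using assms(3)
  proof (induction k arbitrary: z)
    case 0
    then show ?case
      using factor_norm_le[OF assms(1,2), of z n] by (auto simp: finite_comp_Suc)
  next
    case (Suc k)
    have "norm (p (l ^ Suc (Suc n + k) * w) * f z) < 1"
      using factor_norm_le[OF assms(1,2) Suc.prems] assms(2) by (rule le_less_trans)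
    from Suc.IH[OF this] show ?case
      by (simp add: finite_comp_Suc)
  qed
  from this[of "m - Suc n"] show thesis
    using assms(4) that by auto
qed

text \<open>Two long compositions share their first N maps, so they differ by at most the Lipschitz
  constant of that prefix times 2. As N depends only on a and e, this gives both uniformity in the
  parameters and independence of the starting point.\<close>

lemma finite_comp_cauchy:
  assumes a: "a < 1" and e: "e > 0"
  obtains N where "\<And>l w m n x y. (l, w) \<in> region a \<Longrightarrow> m \<ge> N \<Longrightarrow> n \<ge> N \<Longrightarrow> norm x < 1 \<Longrightarrow> norm y < 1
    \<Longrightarrow> dist (FC l w m x) (FC l w n y) < e"
proof (cases "a \<ge> 0")
  \<comment> \<open>For negative a the region is empty.\<close>
  case False
  then show thesis using that region_nonneg by blast
next
  case a0: True
  obtain L where L: "L \<ge> 0"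
    "\<And>x y. x \<in> cball 0 a \<Longrightarrow> y \<in> cball 0 a \<Longrightarrow> norm (f x - f y) \<le> L * norm (x - y)"
    using holomorphic_lipschitz_on_cball[OF f_hol open_ball, of 0 a] a
    by (auto simp: subset_iff)
  have "\<forall>\<^sub>F n in sequentially. (\<Prod>j<n. L * a ^ j) < e / 2"
    using prod_power_tendsto_0[of a L] a a0 e by (intro order_tendstoD) auto
  then obtain N where N: "(\<Prod>j<N. L * a ^ j) < e / 2"
    by (auto simp: eventually_sequentially)
  show thesis
  proof
    fix l w m n x y
    assume H: "(l, w) \<in> region a" "m \<ge> Suc N" "n \<ge> Suc N" "norm (x :: complex) < 1" "norm (y :: complex) < 1"
    obtain x' where x': "x' \<in> cball 0 a" "FC l w m x = FC l w N x'"
      using finite_comp_prefix[of l w a x N m] H a by auto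
    obtain y' where y': "y' \<in> cball 0 a" "FC l w n y = FC l w N y'"
      using finite_comp_prefix[of l w a y N n] H a by auto
    have "norm (x' - y') \<le> 2"
      using norm_triangle_ineq4[of x' y'] x' y' a by auto
    then have "(\<Prod>j<N. L * a ^ j) * norm (x' - y') \<le> (\<Prod>j<N. L * a ^ j) * 2"
      using L a0 by (intro mult_left_mono prod_nonneg) auto
    then show "dist (FC l w m x) (FC l w n y) < e"
      using finite_comp_lipschitz[OF a H(1) L x'(1) y'(1), of N] x' y' N by (simp add: dist_norm)
  qed
qed

lemma uniform_limit_P:
  assumes "a < 1"
  shows "uniform_limit (region a) (\<lambda>n (l, w). FC l w n 0) (\<lambda>(l, w). P l w) sequentially"
proof -
  have "uniformly_Cauchy_on (region a) (\<lambda>n (l, w). FC l w n 0)"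
  proof (rule uniformly_Cauchy_onI)
    fix e :: real assume "e > 0"
    from finite_comp_cauchy[OF assms this]
    show "\<exists>M. \<forall>x\<in>region a. \<forall>m\<ge>M. \<forall>n\<ge>M. dist (case x of (l, w) \<Rightarrow> FC l w m 0) (case x of (l, w) \<Rightarrow> FC l w n 0) < e"
      by (smt (verit) case_prod_conv norm_zero surj_pair)
  qed
  then have "uniformly_convergent_on (region a) (\<lambda>n (l, w). FC l w n 0)"
    by (rule Cauchy_uniformly_convergent)
  then show ?thesis
    unfolding uniformly_convergent_uniform_limit_iff by (simp add: P_def case_prod_unfold)
qed

section \<open>The limit function and its functional equation\<close>

lemma in_region:
  assumes "norm l < 1" "norm (l * w) < 1"
  obtains a where "a < 1" "(l, w) \<in> region a"
  using assms by (intro that[of "max (norm l) (norm (l * w))"]) (auto simp: region_def)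

lemma finite_comp_tendsto_P:
  assumes "norm l < 1" "norm (l * w) < 1" "norm z < 1"
  shows "(\<lambda>n. FC l w n z) \<longlonglongrightarrow> P l w"
proof -
  obtain a where a: "a < 1" "(l, w) \<in> region a" using in_region assms by blast
  have 0: "(\<lambda>n. FC l w n 0) \<longlonglongrightarrow> P l w"
    using tendsto_uniform_limitI[OF uniform_limit_P[OF a(1)] a(2)] by simp
  \<comment> \<open>The Cauchy estimate with m = n compares the starting points z and 0.\<close>
  have "(\<lambda>n. dist (FC l w n z) (FC l w n 0)) \<longlonglongrightarrow> 0"
  proof (rule LIMSEQ_I)
    fix e :: real assume "e > 0"
    from finite_comp_cauchy[OF a(1) this] obtain N where
      "\<And>l w m n x y. (l, w) \<in> region a \<Longrightarrow> m \<ge> N \<Longrightarrow> n \<ge> N \<Longrightarrow> norm x < 1 \<Longrightarrow> norm y < 1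
        \<Longrightarrow> dist (FC l w m x) (FC l w n y) < e" by metis
    then show "\<exists>no. \<forall>n\<ge>no. norm (dist (FC l w n z) (FC l w n 0) - 0) < e"
      using a assms by (intro exI[of _ N]) auto
  qed
  then have "(\<lambda>n. FC l w n z - FC l w n 0) \<longlonglongrightarrow> 0"
    by (simp add: dist_norm tendsto_norm_zero_iff)
  from tendsto_add[OF this 0] show ?thesis by simp
qed

text \<open>The bound a < 1 is uniform in n, so the limit cannot reach the unit circle.\<close>

lemma norm_P:
  assumes "norm l < 1" "norm (l * w) < 1"
  shows "norm (P l w) < 1"
proof -
  obtain a where a: "a < 1" "(l, w) \<in> region a" using in_region assms by blast
  have "(\<lambda>n. FC l w (Suc n) 0) \<longlonglongrightarrow> P l w"
    using finite_comp_tendsto_P[OF assms, of 0] by (intro LIMSEQ_Suc) auto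
  then have "norm (P l w) \<le> a"
    using norm_finite_comp_le[OF a(2,1), of 0]
    by (intro Lim_bounded[OF tendsto_norm]) auto
  then show ?thesis using a by simp
qed

text \<open>Both sides are limits of the same sequence; on the right, f is continuous at
  \<open>P l w\<close> because that value lies in the open disc.\<close>

lemma P_functional_equation:
  assumes "norm l < 1" "norm w < 1" "l \<noteq> 0"
  shows "P l (w / l) = p w * f (P l w)"
proof (rule LIMSEQ_unique)
  have lw: "norm (l * w) < 1" using assms(1,2) by (rule norm_mult_less_1)
  have "isCont f (P l w)"
    using f_hol norm_P[OF assms(1) lw]
    by (metis continuous_on_eq_continuous_at dist_0_norm holomorphic_on_imp_continuous_on mem_ball open_ball)
  then show "(\<lambda>n. FC l (w / l) (Suc n) 0) \<longlonglongrightarrow> p w * f (P l w)"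
    using finite_comp_tendsto_P[OF assms(1) lw, of 0] assms(3)
    by (auto simp: finite_comp_Suc_divide intro!: tendsto_intros isCont_tendsto_compose[of _ f])
  \<comment> \<open>Here l * (w / l) = w lies in the disc even when w / l does not.\<close>
  show "(\<lambda>n. FC l (w / l) (Suc n) 0) \<longlonglongrightarrow> P l (w / l)"
    using finite_comp_tendsto_P[of l "w / l" 0] assms by (intro LIMSEQ_Suc) auto
qed

section \<open>Holomorphy of the limit\<close>

lemma power_mult_in_disc:
  fixes l w :: complex
  assumes "norm l < 1" "norm (l * w) < 1"
  shows "norm (l ^ Suc n * w) < 1"
  using in_region[OF assms] norm_power_mult_less_1 by metis

lemma factor_in_disc:
  assumes "norm l < 1" "norm (l * w) < 1" "norm z < 1"
  shows "norm (p (l ^ Suc n * w) * f z) < 1"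
  using in_region[OF assms(1,2)] factor_norm_le[OF _ _ assms(3)] le_less_trans by metis

text \<open>Letting \<open>A\<close> and \<open>B\<close> be functions covers holomorphy in l and in
  w by one induction. The starting point \<open>g\<close> must vary too, since each step absorbs the
  innermost map into it.\<close>

lemma holomorphic_on_finite_comp:
  assumes "A holomorphic_on S" "B holomorphic_on S" "g holomorphic_on S"
    and "\<And>x. x \<in> S \<Longrightarrow> norm (A x) < 1" "\<And>x. x \<in> S \<Longrightarrow> norm (A x * B x) < 1"
    and "\<And>x. x \<in> S \<Longrightarrow> norm (g x) < 1"
  shows "(\<lambda>x. FC (A x) (B x) n (g x)) holomorphic_on S"
  using assms(3,6)
proof (induction n arbitrary: g)
  case (Suc n)
  have "(\<lambda>x. p (A x ^ Suc n * B x)) holomorphic_on S"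
    using power_mult_in_disc assms(4,5)
    by (intro holomorphic_on_compose_gen[OF _ p_hol, unfolded o_def] holomorphic_intros assms(1,2)) auto
  moreover have "(\<lambda>x. f (g x)) holomorphic_on S"
    using Suc.prems by (intro holomorphic_on_compose_gen[OF _ f_hol, unfolded o_def]) auto
  ultimately show ?case
    unfolding finite_comp_Suc
    by (intro Suc.IH holomorphic_intros factor_in_disc assms Suc.prems)
qed simp

lemma continuous_on_finite_comp:
  fixes A B g :: "'a :: topological_space \<Rightarrow> complex"
  assumes "continuous_on S A" "continuous_on S B" "continuous_on S g"
    and "\<And>x. x \<in> S \<Longrightarrow> norm (A x) < 1" "\<And>x. x \<in> S \<Longrightarrow> norm (A x * B x) < 1"
    and "\<And>x. x \<in> S \<Longrightarrow> norm (g x) < 1"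
  shows "continuous_on S (\<lambda>x. FC (A x) (B x) n (g x))"
  using assms(3,6)
proof (induction n arbitrary: g)
  case (Suc n)
  have "continuous_on S (\<lambda>x. p (A x ^ Suc n * B x))"
    using power_mult_in_disc assms(4,5)
    by (intro continuous_on_compose2[OF holomorphic_on_imp_continuous_on[OF p_hol]] continuous_intros assms(1,2)) auto
  moreover have "continuous_on S (\<lambda>x. f (g x))"
    using Suc.prems by (intro continuous_on_compose2[OF holomorphic_on_imp_continuous_on[OF f_hol]]) auto
  ultimately show ?case
    unfolding finite_comp_Suc
    by (intro Suc.IH continuous_intros factor_in_disc assms Suc.prems)
qed simp

lemma cball_Times_subset_region: "cball 0 a \<times> cball 0 1 \<subseteq> region a"
  by (auto simp: region_def norm_mult) (smt (verit) mult_right_le_one_le norm_ge_zero)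

text \<open>Convergence is uniform only while l stays in a smaller disc, so continuity is shown for
  l in \<open>ball 0 a\<close> with a < 1 and glued over these open sets.\<close>

lemma continuous_on_P: "continuous_on (unit_disc \<times> unit_disc) (\<lambda>(l, w). P l w)"
proof -
  have "continuous_on (ball 0 a \<times> unit_disc) (\<lambda>(l, w). P l w)" if a: "a < 1" for a
  proof (rule uniform_limit_theorem)
    have "continuous_on (ball 0 a \<times> unit_disc) (\<lambda>z. FC (fst z) (snd z) n 0)" for n
      using a by (intro continuous_on_finite_comp continuous_intros) (auto intro!: norm_mult_less_1)
    then show "\<forall>\<^sub>F n in sequentially. continuous_on (ball 0 a \<times> unit_disc) (\<lambda>(l, w). FC l w n 0)"
      by (simp add: case_prod_unfold)
    have "ball 0 a \<times> unit_disc \<subseteq> region a"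
      using cball_Times_subset_region ball_subset_cball by blast
    then show "uniform_limit (ball 0 a \<times> unit_disc) (\<lambda>n (l, w). FC l w n 0) (\<lambda>(l, w). P l w) sequentially"
      using uniform_limit_P[OF a] uniform_limit_on_subset by blast
  qed auto
  then have "continuous_on (\<Union>a\<in>{..<1}. ball 0 a \<times> unit_disc) (\<lambda>(l, w). P l w)"
    by (intro continuous_on_open_UN open_Times) auto
  moreover have "(\<Union>a\<in>{..<1}. ball 0 a \<times> unit_disc) = unit_disc \<times> (unit_disc :: complex set)"
    using dense by fastforce
  ultimately show ?thesis by metis
qed

lemma holomorphic2_P: "holomorphic2_on P (unit_disc \<times> unit_disc)"
proof (rule holomorphic2_on_if_separately_holomorphic)
  fix w :: complex assume w: "w \<in> unit_disc"
  show "(\<lambda>l. P l w) holomorphic_on unit_disc"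
  proof (rule holomorphic_uniform_sequence)
    show "(\<lambda>l. FC l w n 0) holomorphic_on unit_disc" for n
      using w by (intro holomorphic_on_finite_comp holomorphic_intros) (auto intro!: norm_mult_less_1)
    fix l :: complex assume l: "l \<in> unit_disc"
    \<comment> \<open>Half the distance to the unit circle keeps the closed disc about l inside a
      closed disc around 0 of radius below 1, where convergence is uniform.\<close>
    define d where "d = (1 - norm l) / 2"
    have d: "d > 0" "norm l + d < 1"
      using l by (auto simp: d_def field_simps)
    have sub: "cball l d \<subseteq> cball 0 (norm l + d)"
      by (auto simp: dist_norm) (smt (verit) norm_triangle_sub norm_minus_commute)
    have "uniform_limit (cball l d) (\<lambda>n l. FC l w n 0) (\<lambda>l. P l w) sequentially"
      using uniform_limit_compose'[OF uniform_limit_P[OF d(2)], of "\<lambda>l. (l, w)" "cball l d"]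
        sub w cball_Times_subset_region by fastforce
    then show "\<exists>d>0. cball l d \<subseteq> unit_disc \<and>
        uniform_limit (cball l d) (\<lambda>n l. FC l w n 0) (\<lambda>l. P l w) sequentially"
      using d sub by (intro exI[of _ d]) auto
  qed auto
next
  fix l :: complex assume l: "l \<in> unit_disc"
  show "P l holomorphic_on unit_disc"
  proof (rule holomorphic_uniform_sequence)
    show "(\<lambda>w. FC l w n 0) holomorphic_on unit_disc" for n
      using l by (intro holomorphic_on_finite_comp holomorphic_intros) (auto intro!: norm_mult_less_1)
    fix w :: complex assume "w \<in> unit_disc"
    then obtain d where d: "d > 0" "cball w d \<subseteq> unit_disc"
      using open_contains_cball[of unit_disc] open_ball by blast
    \<comment> \<open>For fixed l the single region with a = \<open>norm l\<close> contains (l, w)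
      for every w in the disc.\<close>
    have "uniform_limit (cball w d) (\<lambda>n w. FC l w n 0) (P l) sequentially"
      using uniform_limit_compose'[OF uniform_limit_P[of "norm l"], of "\<lambda>w. (l, w)" "cball w d"]
        d l cball_Times_subset_region[of "norm l"] by fastforce
    then show "\<exists>d>0. cball w d \<subseteq> unit_disc \<and>
        uniform_limit (cball w d) (\<lambda>n w. FC l w n 0) (P l) sequentially"
      using d by blast
  qed auto
qed (auto intro: continuous_on_P)

end

theorem theorem2p2:
  fixes f p :: "complex \<Rightarrow> complex"
  assumes f_hol: "f holomorphic_on unit_disc"
    and f_disc: "f ` unit_disc \<subseteq> unit_disc"
    and p_hol: "p holomorphic_on unit_disc"
    and p_disc: "p ` unit_disc \<subseteq> unit_disc"
    and p_0: "p 0 = 0"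
  shows "\<exists>P :: complex \<Rightarrow> complex \<Rightarrow> complex.
    holomorphic2_on P (unit_disc \<times> unit_disc) \<and>
    (\<forall>l\<in>unit_disc. \<forall>w\<in>unit_disc. P l w \<in> unit_disc) \<and>
    (\<forall>l\<in>unit_disc. \<forall>w\<in>unit_disc. \<forall>z\<in>unit_disc.
        (\<lambda>n. finite_comp f p l w n z) \<longlonglongrightarrow> P l w) \<and>
    (\<forall>l\<in>unit_disc. \<forall>w\<in>unit_disc. l \<noteq> 0 \<longrightarrow>
        (\<forall>z\<in>unit_disc. (\<lambda>n. finite_comp f p l (w / l) n z) \<longlonglongrightarrow> P l (w / l)) \<and>
        P l (w / l) = p w * f (P l w))"
proof -
  interpret disc_self_maps f p
    using assms by unfold_locales
  show ?thesis
    by (intro exI[of _ P])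
       (intro conjI ballI impI holomorphic2_P P_functional_equation finite_comp_tendsto_P;
        simp add: norm_P norm_mult_less_1)
qed

end
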